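(* Let $T$ be a compact metric space, let $t\mapsto a_t\in\mathbb{R}^n$ be a continuous function on $T$, and let $\mathcal{F}:C(T,\mathbb{R})\rightrightarrows\mathbb{R}^n$ be the multifunction $\mathcal{F}(b)=\{x\in\mathbb{R}^n\mid a_t'x\leq b_t,\ t\in T\}$. Then $$\operatorname{Hof}\mathcal{F}=\sup_{\substack{J\subset T\ \text{compact}\\ 0_n\notin\operatorname{conv}\{a_t,\ t\in J\}}}d_*\bigl(0_n,\operatorname{conv}\{a_t,\ t\in J\}\bigr)^{-1}.$$
   Context: $x'y$ is the usual inner product in $\mathbb{R}^n$ and $0_n$ is the zero vector. $\mathbb{R}^n$ is equipped with an arbitrary norm $\|\cdot\|$, with dual norm $\|u\|_*=\max_{\|x\|\leq1}|u'x|$; $d$ is the distance on $\mathbb{R}^n$ induced by $\|\cdot\|$ and $d_*$ the distance induced by $\|\cdot\|_*$. $C(T,\mathbb{R})$ is the space of continuous functions $b=(b_t)_{t\in T}$ from $T$ to $\mathbb{R}$ with the supremum norm $\|b\|_\infty=\max_{t\in T}|b_t|$, whose distance is also denoted by $d$. $\operatorname{conv}$ denotes the convex hull. For a point $z$ and a set $\Omega$, the distance is $\inf_{\omega\in\Omega}$ of the distances from $z$ to $\omega$, with $\inf\emptyset=+\infty$; thus the distance to $\emptyset$ is $+\infty$, and $(+\infty)^{-1}=0$ (in particular, $J=\emptyset$ contributes the value $0$). Also $\sup\emptyset=0$. $\operatorname{dom}\mathcal{F}=\{b\mid\mathcal{F}(b)\neq\emptyset\}$ and $\mathcal{F}^{-1}(x)=\{b\in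 C(T,\mathbb{R})\mid x\in\mathcal{F}(b)\}$. The global Hoffman constant $\operatorname{Hof}\mathcal{F}\in[0,+\infty]$ is the infimum of all $\kappa\geq0$ such that $d(x,\mathcal{F}(b))\leq\kappa\, d(b,\mathcal{F}^{-1}(x))$ for all $x\in\mathbb{R}^n$ and all $b\in\operatorname{dom}\mathcal{F}$ ($+\infty$ if there is no such $\kappa$). *)

theory Defs
  imports "HOL-Analysis.Analysis"
begin

definition is_norm :: "(real ^ 'n \<Rightarrow> real) \<Rightarrow> bool" where
  "is_norm N \<longleftrightarrow>
     (\<forall>x. 0 \<le> N x) \<and> (\<forall>x. N x = 0 \<longleftrightarrow> x = 0) \<and>
     (\<forall>c x. N (c *\<^sub>R x) = \<bar>c\<bar> * N x) \<and> (\<forall>x y. N (x + y) \<le> N x + N y)"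

(* For a norm N on a finite-dimensional space this supremum is finite and attained. *)
definition dual_norm :: "(real ^ 'n \<Rightarrow> real) \<Rightarrow> real ^ 'n \<Rightarrow> real" where
  "dual_norm N u = (SUP x\<in>{x. N x \<le> 1}. \<bar>u \<bullet> x\<bar>)"

definition norm_dist :: "(real ^ 'n \<Rightarrow> real) \<Rightarrow> real ^ 'n \<Rightarrow> real ^ 'n \<Rightarrow> real" where
  "norm_dist N x y = N (x - y)"

(* Values in [0,\<infinity>]: the infimum over the empty set is \<infinity>, unlike for infdist. *)
definition dist_to :: "('b \<Rightarrow> 'b \<Rightarrow> real) \<Rightarrow> 'b \<Rightarrow> 'b set \<Rightarrow> ennreal" where
  "dist_to D z \<Omega> = (INF \<omega>\<in>\<Omega>. ennreal (D z \<omega>))"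

(* C(T,R) for compact T: continuous real functions on T (extensional outside T, so
   that each is represented exactly once) with the supremum distance. *)
definition C_space :: "'a::metric_space set \<Rightarrow> ('a \<Rightarrow> real) metric" where
  "C_space T = cfunspace (top_of_set T) euclidean_metric"

definition feasible_set ::
    "'a set \<Rightarrow> ('a \<Rightarrow> real ^ 'n) \<Rightarrow> ('a \<Rightarrow> real) \<Rightarrow> (real ^ 'n) set" where
  "feasible_set T a b = {x. \<forall>t\<in>T. a t \<bullet> x \<le> b t}"

(* A multifunction from the metric space Y is a set-valued map considered on mspace Y only. *)
definition mf_dom :: "'b metric \<Rightarrow> ('b \<Rightarrow> 'x set) \<Rightarrow> 'b set" where
  "mf_dom Y F = {b \<in> mspace Y. F b \<noteq> {}}"

definition mf_inverse :: "'b metric \<Rightarrow> ('b \<Rightarrow> 'x set) \<Rightarrow> 'x \<Rightarrow> 'b set" where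
  "mf_inverse Y F x = {b \<in> mspace Y. x \<in> F b}"

definition Hof :: "'b metric \<Rightarrow> ('x \<Rightarrow> 'x \<Rightarrow> real) \<Rightarrow> ('b \<Rightarrow> 'x set) \<Rightarrow> ennreal" where
  "Hof Y D F = Inf {ennreal \<kappa> | \<kappa>. 0 \<le> \<kappa> \<and>
     (\<forall>x. \<forall>b\<in>mf_dom Y F.
        dist_to D x (F b) \<le> ennreal \<kappa> * dist_to (mdist Y) b (mf_inverse Y F x))}"

end

theory Submission
  imports Defs
begin

text \<open>
  Upper bound: by compactness of the balls it suffices to bound the distance from \<open>x\<close> to the
  feasible set of a finite subsystem. At a point \<open>p\<close> of that set nearest to \<open>x\<close>, a hyperplane
  separating it from the ball around \<open>x\<close> has a normal in the cone of the active \<open>a t\<close> (Farkas), and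
  by Caratheodory in the cone over a set \<open>J\<close> with \<open>0 \<notin> conv a(J)\<close>. Rescaled to \<open>c \<in> conv a(J)\<close>, it
  gives \<open>N (x - p) * dual_norm N c \<le> c \<bullet> (x - p) \<le> m\<close>, with \<open>m\<close> the largest violation at \<open>x\<close>.
  Passing to finite subsystems avoids the cones of infinite systems, which need not be closed.

  Lower bound: for given \<open>J\<close> one right-hand side and the point \<open>0\<close> suffice, see \<open>Hof_ge\<close>.
\<close>

subsection \<open>Norms and dual norms\<close>

lemma is_normD:
  assumes "is_norm N"
  shows "0 \<le> N x" and "N x = 0 \<longleftrightarrow> x = 0" and "N (c *\<^sub>R x) = \<bar>c\<bar> * N x"
    and "N (x + y) \<le> N x + N y" and "N (- x) = N x" and "N (x - y) = N (y - x)"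
proof -
  show *: "0 \<le> N x" "N x = 0 \<longleftrightarrow> x = 0" "N (c *\<^sub>R x) = \<bar>c\<bar> * N x" "N (x + y) \<le> N x + N y"
    for x y c using assms by (auto simp: is_norm_def)
  show **: "N (- x) = N x" for x
    using *(3)[of "-1" x] by simp
  show "N (x - y) = N (y - x)"
    using **[of "x - y"] by simp
qed

lemma is_norm_convex_on:
  assumes "is_norm N"
  shows "convex_on UNIV N"
proof (rule convex_onI)
  fix t :: real and x y
  assume "0 < t" "t < 1"
  then show "N ((1 - t) *\<^sub>R x + t *\<^sub>R y) \<le> (1 - t) * N x + t * N y"
    using is_normD(4)[OF assms, of "(1 - t) *\<^sub>R x" "t *\<^sub>R y"] by (simp add: is_normD(3)[OF assms])
qed simp

lemma is_norm_continuous_on: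
  fixes N :: "real ^ 'n \<Rightarrow> real"
  assumes "is_norm N"
  shows "continuous_on S N"
  using convex_on_continuous[OF open_UNIV is_norm_convex_on[OF assms]] continuous_on_subset by blast

text \<open>Comparison with the Euclidean norm: \<open>N\<close> attains a positive minimum on the
  compact unit sphere, and homogeneity carries the bound to all vectors. This makes
  \<open>N\<close>-balls compact and the supremum in \<open>dual_norm\<close> finite.\<close>

lemma is_norm_lower_bound:
  fixes N :: "real ^ 'n \<Rightarrow> real"
  assumes "is_norm N"
  obtains c where "0 < c" and "\<And>x. c * norm x \<le> N x"
proof -
  have "sphere 0 1 \<noteq> ({} :: (real ^ 'n) set)" by simp
  then obtain z where z: "z \<in> sphere 0 1" "\<And>y. y \<in> sphere 0 1 \<Longrightarrow> N z \<le> N y"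
    using continuous_attains_inf[OF compact_sphere _ is_norm_continuous_on[OF assms], of 0 1] by blast
  have "z \<noteq> 0" using z(1) by auto
  then have "0 < N z"
    using is_normD(1,2)[OF assms, of z] by linarith
  moreover have "N z * norm x \<le> N x" for x
  proof (cases "x = 0")
    case False
    then have "N z \<le> N ((1 / norm x) *\<^sub>R x)" by (intro z(2)) simp
    with False show ?thesis by (simp add: is_normD(3)[OF assms] field_simps)
  qed (use is_normD(1)[OF assms] in simp)
  ultimately show ?thesis using that by blast
qed

lemma is_norm_compact_ball:
  fixes N :: "real ^ 'n \<Rightarrow> real"
  assumes "is_norm N"
  shows "compact {y. N (x - y) \<le> r}"
proof -
  obtain c where c: "0 < c" "\<And>x. c * norm x \<le> N x" using is_norm_lower_bound[OF assms] by blast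
  have "continuous_on UNIV (\<lambda>y. N (x - y))"
    by (intro continuous_on_compose2[OF is_norm_continuous_on[OF assms, of UNIV]] continuous_intros) auto
  then have "closed {y. N (x - y) \<le> r}"
    by (intro closed_Collect_le continuous_intros)
  moreover have "{y. N (x - y) \<le> r} \<subseteq> cball x (r / c)"
  proof
    fix y assume "y \<in> {y. N (x - y) \<le> r}"
    then have "c * norm (x - y) \<le> r" using c(2)[of "x - y"] by simp
    then show "y \<in> cball x (r / c)" using c(1) by (simp add: dist_norm field_simps)
  qed
  ultimately show ?thesis
    by (meson bounded_cball bounded_subset compact_eq_bounded_closed)
qed

lemma dual_norm_upper:
  fixes N :: "real ^ 'n \<Rightarrow> real"
  assumes "is_norm N"
  shows "\<bar>u \<bullet> x\<bar> \<le> dual_norm N u * N x"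
proof (cases "x = 0")
  case False
  obtain c where c: "0 < c" "\<And>x. c * norm x \<le> N x" using is_norm_lower_bound[OF assms] by blast
  have pos: "0 < N x" using False is_normD(1,2)[OF assms, of x] by linarith
  \<comment> \<open>A real \<open>SUP\<close> dominates its members only over a bounded family;
    Cauchy-Schwarz and the comparison with the Euclidean norm give the bound.\<close>
  have "bdd_above ((\<lambda>x. \<bar>u \<bullet> x\<bar>) ` {x. N x \<le> 1})"
  proof (rule bdd_aboveI2)
    fix x assume "x \<in> {x. N x \<le> 1}"
    then have "norm x \<le> 1 / c" using c(1) c(2)[of x] by (simp add: field_simps)
    then have "norm u * norm x \<le> norm u * (1 / c)" by (intro mult_left_mono) auto
    then show "\<bar>u \<bullet> x\<bar> \<le> norm u * (1 / c)" using Cauchy_Schwarz_ineq2[of u x] by linarith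
  qed
  then have "\<bar>u \<bullet> ((1 / N x) *\<^sub>R x)\<bar> \<le> dual_norm N u"
    unfolding dual_norm_def using pos by (intro cSUP_upper) (auto simp: is_normD(3)[OF assms])
  with pos show ?thesis by (simp add: field_simps abs_mult)
qed (use is_normD(2)[OF assms, of 0] in simp)

lemma dual_norm_pos:
  assumes "is_norm N" and "u \<noteq> 0"
  shows "0 < dual_norm N u"
proof -
  have "0 < \<bar>u \<bullet> u\<bar>" "0 \<le> N u" using assms by (auto simp: is_normD(1))
  with dual_norm_upper[OF assms(1), of u u] have "0 < dual_norm N u * N u" by linarith
  with \<open>0 \<le> N u\<close> show ?thesis by (simp add: zero_less_mult_iff)
qed

lemma dual_norm_le:
  assumes "is_norm N" and "\<And>x. N x \<le> 1 \<Longrightarrow> \<bar>u \<bullet> x\<bar> \<le> d"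
  shows "dual_norm N u \<le> d"
proof -
  have "0 \<in> {x. N x \<le> 1}" using is_normD(2)[OF assms(1), of 0] by simp
  then show ?thesis unfolding dual_norm_def using assms(2) by (intro cSUP_least) auto
qed

text \<open>The open \<open>N\<close>-ball around \<open>x\<close> with radius the distance to
  \<open>F\<close> misses \<open>F\<close>, and \<open>u\<close> is the normal of a separating
  hyperplane. The last conclusion is a pointwise form of
  \<open>N (x - p) * dual_norm N u \<le> u \<bullet> (x - p)\<close>: the pair \<open>u\<close>,
  \<open>x - p\<close> attains equality in the duality inequality.\<close>

lemma nearest_point_normal:
  fixes N :: "real ^ 'n \<Rightarrow> real"
  assumes N: "is_norm N" and F: "closed F" "convex F" "F \<noteq> {}" and x: "x \<notin> F"
  obtains p u where "p \<in> F" and "u \<noteq> 0" and "0 < N (x - p)"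
    and "\<And>y. y \<in> F \<Longrightarrow> u \<bullet> y \<le> u \<bullet> p"
    and "\<And>w. N w \<le> 1 \<Longrightarrow> N (x - p) * \<bar>u \<bullet> w\<bar> \<le> u \<bullet> (x - p)"
proof -
  obtain y0 where y0: "y0 \<in> F" using F by auto
  \<comment> \<open>Cutting \<open>F\<close> down to the points no farther from \<open>x\<close>
    than \<open>y0\<close> gives a compact set; the discarded points cannot be nearest.\<close>
  define B where "B = F \<inter> {y. N (x - y) \<le> N (x - y0)}"
  have "compact B" "B \<noteq> {}"
    using F y0 is_norm_compact_ball[OF N] by (auto simp: B_def closed_Int_compact)
  moreover have "continuous_on B (\<lambda>y. N (x - y))"
    by (intro continuous_on_compose2[OF is_norm_continuous_on[OF N, of UNIV]] continuous_intros) auto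
  ultimately obtain p where p: "p \<in> B" "\<And>y. y \<in> B \<Longrightarrow> N (x - p) \<le> N (x - y)"
    using continuous_attains_inf by metis
  have pF: "p \<in> F" using p(1) by (simp add: B_def)
  have min: "N (x - p) \<le> N (x - y)" if "y \<in> F" for y
    using p that by (cases "N (x - y) \<le> N (x - y0)") (auto simp: B_def)
  define \<rho> where "\<rho> = N (x - p)"
  have \<rho>: "0 < \<rho>" using x pF is_normD(1,2)[OF N, of "x - p"] by (auto simp: \<rho>_def)
  define G where "G = {z. N (z - x) < \<rho>}"
  have "convex G"
  proof (rule convexI)
    fix y z and s t :: real
    assume yz: "y \<in> G" "z \<in> G" and st: "0 \<le> s" "0 \<le> t" "s + t = 1"
    have "s *\<^sub>R y + t *\<^sub>R z - x = s *\<^sub>R (y - x) + t *\<^sub>R (z - x)"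
      using scaleR_left_distrib[of s t x] st by (simp add: algebra_simps)
    then have "N (s *\<^sub>R y + t *\<^sub>R z - x) \<le> s * N (y - x) + t * N (z - x)"
      using is_normD(4)[OF N, of "s *\<^sub>R (y - x)" "t *\<^sub>R (z - x)"] st by (simp add: is_normD(3)[OF N])
    also have "\<dots> < \<rho>"
      using yz st by (intro convex_bound_lt) (auto simp: G_def)
    finally show "s *\<^sub>R y + t *\<^sub>R z \<in> G" by (simp add: G_def)
  qed
  moreover have "x \<in> G" using \<rho> is_normD(2)[OF N, of 0] by (simp add: G_def)
  moreover have "F \<inter> G = {}" using min is_normD(6)[OF N] by (fastforce simp: G_def \<rho>_def)
  ultimately obtain u \<beta> where u: "u \<noteq> 0" "\<And>y. y \<in> F \<Longrightarrow> u \<bullet> y \<le> \<beta>" "\<And>z. z \<in> G \<Longrightarrow> \<beta> \<le> u \<bullet> z"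
    using separating_hyperplane_sets[OF F(2), of G] F(3) by blast
  \<comment> \<open>Only the open ball lies on the far side of the hyperplane, so \<open>w\<close>
    is first shrunk by a factor \<open>s < 1\<close>, and then \<open>s\<close> tends to 1.\<close>
  have ball: "\<rho> * (u \<bullet> w) \<le> u \<bullet> x - \<beta>" if w: "N w \<le> 1" for w
  proof (rule field_le_mult_one_interval)
    fix s :: real assume s: "0 < s" "s < 1"
    have "N (x - (s * \<rho>) *\<^sub>R w - x) = s * \<rho> * N w"
      using s \<rho> is_normD(5)[OF N, of "(s * \<rho>) *\<^sub>R w"] by (simp add: is_normD(3)[OF N])
    also have "\<dots> \<le> s * \<rho>" using w s \<rho> by (simp add: mult_left_le)
    also have "\<dots> < \<rho>" using s \<rho> by simp
    finally have "\<beta> \<le> u \<bullet> (x - (s * \<rho>) *\<^sub>R w)" by (intro u(3)) (simp add: G_def)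
    then show "s * (\<rho> * (u \<bullet> w)) \<le> u \<bullet> x - \<beta>" by (simp add: inner_diff_right)
  qed
  \<comment> \<open>Testing with the unit vector along \<open>x - p\<close> shows that the
    hyperplane passes through \<open>p\<close>.\<close>
  have "N ((1 / \<rho>) *\<^sub>R (x - p)) \<le> 1" using \<rho> by (simp add: is_normD(3)[OF N] flip: \<rho>_def)
  from ball[OF this] have "u \<bullet> (x - p) \<le> u \<bullet> x - \<beta>" using \<rho> by simp
  then have \<beta>: "u \<bullet> p = \<beta>" using u(2)[OF pF] by (simp add: inner_diff_right)
  show ?thesis
  proof (rule that[OF pF u(1)])
    show "N (x - p) * \<bar>u \<bullet> w\<bar> \<le> u \<bullet> (x - p)" if "N w \<le> 1" for w
      using ball[OF that] ball[of "- w"] that is_normD(5)[OF N, of w]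
      by (auto simp: \<beta> inner_diff_right abs_if simp flip: \<rho>_def)
  qed (use \<rho> u(2) \<beta> in \<open>auto simp: \<rho>_def\<close>)
qed


subsection \<open>Finitely generated cones\<close>

lemma sum_in_convex_cone_hull:
  assumes "\<And>v. v \<in> S \<Longrightarrow> 0 \<le> k v"
  shows "(\<Sum>v\<in>S. k v *\<^sub>R v) \<in> convex_cone hull S"
  using assms
proof (induction S rule: infinite_finite_induct)
  case (insert v S)
  have "convex_cone hull S \<subseteq> convex_cone hull (insert v S)" by (intro hull_mono) auto
  moreover have "(\<Sum>v\<in>S. k v *\<^sub>R v) \<in> convex_cone hull S" "0 \<le> k v"
    using insert by auto
  ultimately show ?case
    using insert.hyps by (auto intro!: convex_cone_hull_add intro: convex_cone_hull_mul hull_inc)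
qed (auto simp: convex_cone_hull_contains_0)

text \<open>Caratheodory's exchange argument: subtract a multiple of a vanishing convex combination.\<close>

lemma convex_cone_hull_support:
  fixes u :: "'a::real_vector"
  assumes "finite A" and "u \<in> convex_cone hull A" and "u \<noteq> 0"
  obtains B where "B \<subseteq> A" and "u \<in> convex_cone hull B" and "0 \<notin> convex hull B"
  using assms
proof (induction A arbitrary: thesis rule: finite_psubset_induct)
  case (psubset A)
  show ?case
  proof (cases "0 \<in> convex hull A")
    case True
    then obtain \<mu> where \<mu>: "\<And>v. v \<in> A \<Longrightarrow> 0 \<le> \<mu> v" "sum \<mu> A = 1" "(\<Sum>v\<in>A. \<mu> v *\<^sub>R v) = 0"
      using psubset.hyps by (auto simp: convex_hull_finite)
    obtain x c where "x \<in> convex hull A" "0 \<le> c" "u = c *\<^sub>R x"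
      using psubset.prems by (auto simp: convex_cone_hull_convex_hull)
    moreover then obtain k where "\<And>v. v \<in> A \<Longrightarrow> 0 \<le> k v" "(\<Sum>v\<in>A. k v *\<^sub>R v) = x"
      using psubset.hyps by (auto simp: convex_hull_finite)
    ultimately obtain l where l: "\<And>v. v \<in> A \<Longrightarrow> 0 \<le> l v" "u = (\<Sum>v\<in>A. l v *\<^sub>R v)"
      by (intro that[of "\<lambda>v. c * k v"]) (auto simp: scaleR_sum_right)
    define P where "P = {v \<in> A. 0 < \<mu> v}"
    have "P \<noteq> {}"
    proof
      assume "P = {}"
      then have "\<mu> v = 0" if "v \<in> A" for v using \<mu>(1)[OF that] that by (force simp: P_def)
      with \<mu>(2) show False by simp
    qed
    moreover have "finite P" using psubset.hyps by (simp add: P_def)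
    ultimately obtain w where w: "w \<in> P" "\<And>v. v \<in> P \<Longrightarrow> l w / \<mu> w \<le> l v / \<mu> v"
      using arg_min_if_finite[of P "\<lambda>v. l v / \<mu> v"] by (metis linorder_not_less)
    \<comment> \<open>The smallest ratio is the largest multiple of \<mu> that can be subtracted
      from \<open>l\<close> with all coefficients staying nonnegative; the coefficient of
      \<open>w\<close> becomes 0.\<close>
    define \<theta> where "\<theta> = l w / \<mu> w"
    have \<theta>: "0 \<le> \<theta>" using w(1) l(1) by (simp add: \<theta>_def P_def)
    define \<nu> where "\<nu> = (\<lambda>v. l v - \<theta> * \<mu> v)"
    have nonneg: "0 \<le> \<nu> v" if "v \<in> A" for v
    proof (cases "v \<in> P")
      case True
      with w(2)[OF True] show ?thesis by (simp add: \<nu>_def \<theta>_def P_def field_simps)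
    next
      case False
      then have "\<mu> v = 0" using \<mu>(1)[OF that] that by (simp add: P_def)
      with l(1)[OF that] show ?thesis by (simp add: \<nu>_def)
    qed
    have wA: "w \<in> A" and "\<nu> w = 0" using w(1) by (auto simp: P_def \<nu>_def \<theta>_def)
    have "u = (\<Sum>v\<in>A. l v *\<^sub>R v) - \<theta> *\<^sub>R (\<Sum>v\<in>A. \<mu> v *\<^sub>R v)"
      using l(2) \<mu>(3) by simp
    also have "\<dots> = (\<Sum>v\<in>A. \<nu> v *\<^sub>R v)"
      by (simp add: \<nu>_def scaleR_sum_right scaleR_diff_left sum_subtractf)
    also have "\<dots> = (\<Sum>v\<in>A - {w}. \<nu> v *\<^sub>R v)"
      using \<open>\<nu> w = 0\<close> wA psubset.hyps by (simp add: sum.remove)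
    also have "\<dots> \<in> convex_cone hull (A - {w})"
      using nonneg by (intro sum_in_convex_cone_hull) auto
    finally have "u \<in> convex_cone hull (A - {w})" .
    moreover have "A - {w} \<subset> A" using wA by auto
    ultimately obtain B where "B \<subseteq> A - {w}" "u \<in> convex_cone hull B" "0 \<notin> convex hull B"
      using psubset.IH psubset.prems(3) by blast
    then show ?thesis using psubset.prems(1) by blast
  qed (use psubset.prems in blast)
qed

text \<open>A finitely generated cone is closed, so a point outside it can be strictly separated
  from it; the negated normal then violates the hypothesis.\<close>

lemma farkas:
  fixes A :: "'a::euclidean_space set"
  assumes "finite A" and le: "\<And>v. (\<And>w. w \<in> A \<Longrightarrow> v \<bullet> w \<le> 0) \<Longrightarrow> v \<bullet> u \<le> 0"
  shows "u \<in> convex_cone hull A"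
proof (rule ccontr)
  let ?K = "convex_cone hull A"
  assume "u \<notin> ?K"
  moreover have "closed ?K"
    using closed_convex_cone_hull assms(1) by blast
  ultimately obtain v \<beta> where v: "v \<bullet> u < \<beta>" "\<And>w. w \<in> ?K \<Longrightarrow> \<beta> < v \<bullet> w"
    using separating_hyperplane_closed_point[OF convex_convex_cone_hull] by blast
  have "\<beta> < 0" using v(2)[OF convex_cone_hull_contains_0] by simp
  \<comment> \<open>If \<open>v \<bullet> w\<close> were negative, a nonnegative multiple of
    \<open>w\<close> would lie in the cone and give \<open>v\<close> exactly the value \<beta>,
    against the strict separation.\<close>
  have "0 \<le> v \<bullet> w" if "w \<in> A" for w
  proof (rule ccontr)
    assume neg: "\<not> 0 \<le> v \<bullet> w"
    then have "(\<beta> / (v \<bullet> w)) *\<^sub>R w \<in> ?K"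
      using \<open>\<beta> < 0\<close> that by (intro convex_cone_hull_mul hull_inc) (auto simp: divide_nonpos_neg)
    from v(2)[OF this] neg show False by simp
  qed
  then have "(- v) \<bullet> u \<le> 0" by (intro le) simp
  with v(1) \<open>\<beta> < 0\<close> show False by simp
qed


subsection \<open>Error bounds\<close>

text \<open>The hypothesis on \<open>\<kappa>\<close> is the division-free form of "the inverse dual
  distance from 0 to the hull is at most \<open>\<kappa>\<close>"; for empty \<open>J\<close> it is
  vacuous, matching the value 0 of that term.\<close>

lemma finite_system_error_bound:
  fixes N :: "real ^ 'n \<Rightarrow> real"
  assumes N: "is_norm N" and T: "finite T" and ne: "feasible_set T a b \<noteq> {}"
    and viol: "\<And>t. t \<in> T \<Longrightarrow> a t \<bullet> x - b t \<le> m" and "0 \<le> m" and "0 \<le> \<kappa>"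
    and \<kappa>: "\<And>J c. J \<subseteq> T \<Longrightarrow> 0 \<notin> convex hull (a ` J) \<Longrightarrow> c \<in> convex hull (a ` J)
               \<Longrightarrow> 1 \<le> \<kappa> * dual_norm N c"
  obtains y where "y \<in> feasible_set T a b" and "N (x - y) \<le> \<kappa> * m"
proof (cases "x \<in> feasible_set T a b")
  case True
  show ?thesis
    by (rule that[OF True]) (use assms(5,6) is_normD(2)[OF N, of 0] in simp)
next
  case False
  let ?F = "feasible_set T a b"
  have F: "?F = (\<Inter>t\<in>T. {y. a t \<bullet> y \<le> b t})" by (auto simp: feasible_set_def)
  have "closed ?F" "convex ?F"
    unfolding F by (auto intro!: convex_INT closed_INT closed_halfspace_le convex_halfspace_le)
  then obtain p u where p: "p \<in> ?F" and u0: "u \<noteq> 0" and \<rho>: "0 < N (x - p)"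
    and up: "\<And>y. y \<in> ?F \<Longrightarrow> u \<bullet> y \<le> u \<bullet> p"
    and dual: "\<And>w. N w \<le> 1 \<Longrightarrow> N (x - p) * \<bar>u \<bullet> w\<bar> \<le> u \<bullet> (x - p)"
    using nearest_point_normal[OF N _ _ ne False] by metis
  define A where "A = {t \<in> T. a t \<bullet> p = b t}"
  have "u \<in> convex_cone hull (a ` A)"
  proof (rule farkas)
    fix v assume v: "\<And>w. w \<in> a ` A \<Longrightarrow> v \<bullet> w \<le> 0"
    \<comment> \<open>A short step from \<open>p\<close> along \<open>v\<close> stays feasible:
      active constraints do not increase and inactive ones have slack. Finiteness of
      \<open>T\<close> yields a common step length, and maximality of \<open>u\<close> at
      \<open>p\<close> then gives \<open>u \<bullet> v \<le> 0\<close>.\<close>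
    have "\<forall>\<^sub>F \<epsilon> in at_right 0. a t \<bullet> (p + \<epsilon> *\<^sub>R v) \<le> b t" if t: "t \<in> T" for t
    proof (cases "t \<in> A")
      case True
      show ?thesis
        using eventually_at_right_less[of "0::real"]
      proof eventually_elim
        case (elim \<epsilon>)
        have "\<epsilon> * (a t \<bullet> v) \<le> 0"
          using elim v[of "a t"] True by (simp add: mult_nonneg_nonpos inner_commute)
        with True show ?case by (simp add: A_def inner_add_right)
      qed
    next
      case False
      have "((\<lambda>\<epsilon>. a t \<bullet> (p + \<epsilon> *\<^sub>R v)) \<longlongrightarrow> a t \<bullet> (p + 0 *\<^sub>R v)) (at_right 0)"
        by (intro tendsto_intros)
      moreover have "a t \<bullet> (p + 0 *\<^sub>R v) < b t"
        using False t p by (force simp: A_def feasible_set_def)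
      ultimately have "\<forall>\<^sub>F \<epsilon> in at_right 0. a t \<bullet> (p + \<epsilon> *\<^sub>R v) < b t"
        by (rule order_tendstoD)
      then show ?thesis by eventually_elim simp
    qed
    then have "\<forall>\<^sub>F \<epsilon> in at_right 0. \<forall>t\<in>T. a t \<bullet> (p + \<epsilon> *\<^sub>R v) \<le> b t"
      using T by (intro eventually_ball_finite) auto
    then have "\<forall>\<^sub>F \<epsilon> in at_right 0. 0 < \<epsilon> \<and> p + \<epsilon> *\<^sub>R v \<in> ?F"
      using eventually_at_right_less[of "0::real"] by eventually_elim (simp add: feasible_set_def)
    then obtain \<epsilon> where "0 < \<epsilon>" "p + \<epsilon> *\<^sub>R v \<in> ?F"
      using eventually_happens' trivial_limit_at_right_real by blast
    with up have "\<epsilon> * (u \<bullet> v) \<le> 0" by (force simp: inner_add_right)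
    with \<open>0 < \<epsilon>\<close> show "v \<bullet> u \<le> 0" by (simp add: mult_le_0_iff inner_commute)
  qed (simp add: A_def T)
  then obtain B where B: "B \<subseteq> a ` A" "u \<in> convex_cone hull B" "0 \<notin> convex hull B"
    using convex_cone_hull_support[of "a ` A" u] T u0 by (auto simp: A_def)
  obtain J where J: "J \<subseteq> A" "B = a ` J" using B(1) by (meson subset_imageE)
  \<comment> \<open>Since \<open>u\<close> is nonzero it is not merely the apex of the cone, hence a
    positive multiple of a point of the hull.\<close>
  obtain c L where c: "c \<in> convex hull B" "0 \<le> L" "u = L *\<^sub>R c"
    using B(2) u0 by (auto simp: convex_cone_hull_convex_hull)
  have L: "0 < L" using c u0 by (cases "L = 0") auto
  have dual_c: "dual_norm N c \<le> c \<bullet> (x - p) / N (x - p)"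
  proof (rule dual_norm_le[OF N])
    fix w assume "N w \<le> 1"
    from dual[OF this] have "L * (N (x - p) * \<bar>c \<bullet> w\<bar>) \<le> L * (c \<bullet> (x - p))"
      using L by (simp add: c(3) abs_mult mult.left_commute)
    then show "\<bar>c \<bullet> w\<bar> \<le> c \<bullet> (x - p) / N (x - p)" using L \<rho> by (simp add: field_simps)
  qed
  \<comment> \<open>For an active \<open>t\<close>, \<open>a t \<bullet> (x - p)\<close> is exactly
    the violation \<open>a t \<bullet> x - b t\<close>; the bound \<open>m\<close> passes to convex
    combinations.\<close>
  have "convex hull B \<subseteq> {v. (x - p) \<bullet> v \<le> m}"
  proof (rule hull_minimal)
    have "(x - p) \<bullet> a t \<le> m" if "t \<in> J" for t
    proof -
      have "t \<in> T" "a t \<bullet> p = b t" using that J by (auto simp: A_def)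
      with viol[of t] show ?thesis by (simp add: inner_diff_right inner_commute[of "x - p"])
    qed
    then show "B \<subseteq> {v. (x - p) \<bullet> v \<le> m}" using J by auto
  qed (rule convex_halfspace_le)
  then have cm: "c \<bullet> (x - p) \<le> m" using c(1) by (auto simp: inner_commute)
  have "1 \<le> \<kappa> * dual_norm N c"
    using \<kappa>[of J c] J B c by (auto simp: A_def)
  also have "\<dots> \<le> \<kappa> * (c \<bullet> (x - p) / N (x - p))"
    using dual_c \<open>0 \<le> \<kappa>\<close> by (rule mult_left_mono)
  finally have "N (x - p) \<le> \<kappa> * (c \<bullet> (x - p))" using \<rho> by (simp add: field_simps)
  also have "\<dots> \<le> \<kappa> * m" using cm \<open>0 \<le> \<kappa>\<close> by (rule mult_left_mono)
  finally show ?thesis using that p by blast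
qed

text \<open>Finite intersection property in the compact \<open>N\<close>-ball of radius
  \<open>\<kappa> * m\<close>: every finite subsystem has a solution in this same ball, because
  \<open>\<kappa>\<close> and \<open>m\<close> do not depend on the subsystem.\<close>

lemma semi_infinite_system_error_bound:
  fixes N :: "real ^ 'n \<Rightarrow> real"
  assumes N: "is_norm N" and ne: "feasible_set T a b \<noteq> {}"
    and viol: "\<And>t. t \<in> T \<Longrightarrow> a t \<bullet> x - b t \<le> m" and "0 \<le> m" and "0 \<le> \<kappa>"
    and \<kappa>: "\<And>J c. J \<subseteq> T \<Longrightarrow> finite J \<Longrightarrow> 0 \<notin> convex hull (a ` J) \<Longrightarrow> c \<in> convex hull (a ` J)
               \<Longrightarrow> 1 \<le> \<kappa> * dual_norm N c"
  obtains y where "y \<in> feasible_set T a b" and "N (x - y) \<le> \<kappa> * m"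
proof -
  have "{y. N (x - y) \<le> \<kappa> * m} \<inter> (\<Inter>t\<in>T. {y. a t \<bullet> y \<le> b t}) \<noteq> {}"
  proof (rule compact_imp_fip_image[OF is_norm_compact_ball[OF N]])
    fix I assume I: "finite I" "I \<subseteq> T"
    have "feasible_set I a b \<noteq> {}" using ne I by (auto simp: feasible_set_def)
    moreover have "1 \<le> \<kappa> * dual_norm N c"
      if "J \<subseteq> I" "0 \<notin> convex hull (a ` J)" "c \<in> convex hull (a ` J)" for J c
      using that I by (intro \<kappa>[of J]) (auto intro: finite_subset)
    ultimately obtain y where "y \<in> feasible_set I a b" "N (x - y) \<le> \<kappa> * m"
      using finite_system_error_bound[OF N I(1), of a b x m \<kappa>] viol I(2) assms(4,5) by blast
    then show "{y. N (x - y) \<le> \<kappa> * m} \<inter> (\<Inter>t\<in>I. {y. a t \<bullet> y \<le> b t}) \<noteq> {}"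
      by (auto simp: feasible_set_def)
  qed (rule closed_halfspace_le)
  then show ?thesis using that by (auto simp: feasible_set_def)
qed


subsection \<open>The Hoffman constant\<close>

lemma mspace_C_space:
  assumes "compact T"
  shows "f \<in> mspace (C_space T) \<longleftrightarrow> f \<in> extensional T \<and> continuous_on T f"
proof -
  have "compactin (top_of_set T) (topspace (top_of_set T))"
    using assms by (simp add: compact_space_def[symmetric] compact_space_subtopology)
  from compactin_mspace_cfunspace[OF this] show ?thesis
    using assms by (auto simp: C_space_def intro!: compact_imp_bounded compact_continuous_image)
qed

lemma mdist_C_space_upper:
  assumes "f \<in> mspace (C_space T)" and "g \<in> mspace (C_space T)" and "t \<in> T"
  shows "\<bar>f t - g t\<bar> \<le> mdist (C_space T) f g"
  using mdist_cfunspace_imp_mdist_le[OF assms(1,2)[unfolded C_space_def] order_refl] assms(3)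
  by (simp add: C_space_def dist_real_def)

lemma mdist_C_space_le:
  assumes "0 \<le> B" and "\<And>t. t \<in> T \<Longrightarrow> \<bar>f t - g t\<bar> \<le> B"
  shows "mdist (C_space T) f g \<le> B"
  unfolding C_space_def using assms by (intro mdist_cfunspace_le) (auto simp: dist_real_def)

lemma restrict_in_mspace_C_space:
  assumes "compact T" and "continuous_on T f"
  shows "restrict f T \<in> mspace (C_space T)"
  using assms by (simp add: mspace_C_space cong: continuous_on_cong)

lemma ennreal_inverse_antimono:
  fixes x y :: ennreal
  shows "x \<le> y \<Longrightarrow> inverse y \<le> inverse x"
  by (simp add: less_eq_ennreal.rep_eq inverse_ennreal.rep_eq ereal_inverse_antimono)

text \<open>If \<open>x\<close> is feasible for \<open>b'\<close>, then \<open>x\<close> violates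
  the system with data \<open>b\<close> by at most the distance from \<open>b\<close> to
  \<open>b'\<close>. The error bound applies with this distance as \<open>m\<close>, and the infimum
  over \<open>b'\<close> remains.\<close>

lemma Hof_le:
  fixes N :: "real ^ 'n \<Rightarrow> real"
  assumes N: "is_norm N" and T: "compact T" and a: "continuous_on T a" and "0 \<le> \<kappa>"
    and \<kappa>: "\<And>J c. J \<subseteq> T \<Longrightarrow> finite J \<Longrightarrow> 0 \<notin> convex hull (a ` J) \<Longrightarrow> c \<in> convex hull (a ` J)
               \<Longrightarrow> 1 \<le> \<kappa> * dual_norm N c"
  shows "Hof (C_space T) (norm_dist N) (feasible_set T a) \<le> ennreal \<kappa>"
proof -
  let ?Y = "C_space T" and ?F = "feasible_set T a"
  have "dist_to (norm_dist N) x (?F b) \<le> ennreal \<kappa> * dist_to (mdist ?Y) b (mf_inverse ?Y ?F x)"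
    (is "?d \<le> _") if b: "b \<in> mf_dom ?Y ?F" for x b
  proof -
    have le: "?d \<le> ennreal \<kappa> * ennreal (mdist ?Y b b')" if b': "b' \<in> mf_inverse ?Y ?F x" for b'
    proof -
      have "a t \<bullet> x - b t \<le> mdist ?Y b b'" if "t \<in> T" for t
        using mdist_C_space_upper[of b T b' t] b b' that
        by (force simp: mf_dom_def mf_inverse_def feasible_set_def)
      then obtain y where "y \<in> ?F b" "N (x - y) \<le> \<kappa> * mdist ?Y b b'"
        using semi_infinite_system_error_bound[OF N, of T a b x "mdist ?Y b b'" \<kappa>] b \<kappa> \<open>0 \<le> \<kappa>\<close>
        by (auto simp: mf_dom_def)
      then show ?thesis
        unfolding dist_to_def norm_dist_def using \<open>0 \<le> \<kappa>\<close>
        by (intro INF_lower2[of y]) (auto simp flip: ennreal_mult intro!: ennreal_leI)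
    qed
    \<comment> \<open>One member of the inverse image settles the case \<open>\<kappa> = 0\<close>,
      where dividing by \<open>\<kappa>\<close> to reach the infimum is impossible.\<close>
    have "restrict (\<lambda>t. a t \<bullet> x) T \<in> mf_inverse ?Y ?F x"
      using restrict_in_mspace_C_space[OF T, of "\<lambda>t. a t \<bullet> x"] a
      by (simp add: mf_inverse_def feasible_set_def continuous_on_inner)
    note le0 = le[OF this]
    show ?thesis
    proof (cases "\<kappa> = 0")
      case False
      then have pos: "0 < ennreal \<kappa>" using \<open>0 \<le> \<kappa>\<close> by simp
      have "?d / ennreal \<kappa> \<le> dist_to (mdist ?Y) b (mf_inverse ?Y ?F x)"
        unfolding dist_to_def[of "mdist ?Y"]
        by (intro INF_greatest divide_le_posI_ennreal[OF pos] le)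
      then have "ennreal \<kappa> * (?d / ennreal \<kappa>) \<le> ennreal \<kappa> * dist_to (mdist ?Y) b (mf_inverse ?Y ?F x)"
        by (rule mult_left_mono) simp
      then show ?thesis
        using pos by (simp add: ennreal_times_divide ennreal_mult_divide_eq mult.commute[of "ennreal \<kappa>" ?d])
    qed (use le0 in simp)
  qed
  then show ?thesis
    unfolding Hof_def using \<open>0 \<le> \<kappa>\<close> by (intro Inf_lower) blast
qed

text \<open>The data \<open>b = max (-1) (a \<bullet> v)\<close>, where \<open>v\<close> strictly separates the hull from the origin, has
  the feasible point \<open>v\<close>, is violated by at most 1 at the origin, and equals \<open>-1\<close> on \<open>J\<close>.\<close>

lemma Hof_ge:
  fixes N :: "real ^ 'n \<Rightarrow> real"
  assumes N: "is_norm N" and T: "compact T" and a: "continuous_on T a"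
    and J: "J \<subseteq> T" "compact J" "0 \<notin> convex hull (a ` J)"
  shows "inverse (dist_to (norm_dist (dual_norm N)) 0 (convex hull (a ` J)))
    \<le> Hof (C_space T) (norm_dist N) (feasible_set T a)" (is "inverse ?\<delta> \<le> _")
  unfolding Hof_def
proof (rule Inf_greatest, clarify)
  let ?Y = "C_space T" and ?F = "feasible_set T a"
  fix \<kappa> :: real
  assume \<kappa>: "\<forall>x. \<forall>b\<in>mf_dom ?Y ?F.
    dist_to (norm_dist N) x (?F b) \<le> ennreal \<kappa> * dist_to (mdist ?Y) b (mf_inverse ?Y ?F x)"
  have "compact (convex hull (a ` J))"
    using J a by (intro compact_convex_hull compact_continuous_image) (auto intro: continuous_on_subset)
  then obtain w \<beta> where w: "0 < \<beta>" "\<And>z. z \<in> convex hull (a ` J) \<Longrightarrow> \<beta> < w \<bullet> z"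
    using separating_hyperplane_closed_0[OF convex_convex_hull compact_imp_closed J(3)] by blast
  \<comment> \<open>The sign and the factor 1/\<beta> turn \<open>\<beta> < w \<bullet> a t\<close>
    into \<open>a t \<bullet> v \<le> - 1\<close> on \<open>J\<close>.\<close>
  define v where "v = (- 1 / \<beta>) *\<^sub>R w"
  have v: "a t \<bullet> v \<le> - 1" if "t \<in> J" for t
    using w(1) w(2)[of "a t"] that by (simp add: v_def hull_inc inner_commute field_simps)
  define b where "b = restrict (\<lambda>t. max (- 1) (a t \<bullet> v)) T"
  have bY: "b \<in> mspace ?Y"
    unfolding b_def using a by (intro restrict_in_mspace_C_space[OF T] continuous_intros)
  have "v \<in> ?F b" by (simp add: feasible_set_def b_def)
  with bY have dom: "b \<in> mf_dom ?Y ?F" by (auto simp: mf_dom_def)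
  \<comment> \<open>Raising the negative values of \<open>b\<close> to 0 makes the origin feasible,
    and costs at most 1 because \<open>b\<close> is at least -1 on \<open>T\<close>.\<close>
  define b' where "b' = restrict (\<lambda>t. max 0 (b t)) T"
  have "continuous_on T b" using bY mspace_C_space[OF T] by blast
  then have "b' \<in> mspace ?Y"
    unfolding b'_def by (intro restrict_in_mspace_C_space[OF T] continuous_intros)
  then have "b' \<in> mf_inverse ?Y ?F 0"
    by (auto simp: mf_inverse_def feasible_set_def b'_def)
  moreover have "mdist ?Y b b' \<le> 1"
    by (rule mdist_C_space_le) (auto simp: b'_def b_def)
  ultimately have "dist_to (mdist ?Y) b (mf_inverse ?Y ?F 0) \<le> 1"
    unfolding dist_to_def by (intro INF_lower2[of b']) auto
  then have "ennreal \<kappa> * dist_to (mdist ?Y) b (mf_inverse ?Y ?F 0) \<le> ennreal \<kappa> * 1"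
    by (rule mult_left_mono) simp
  then have upper: "dist_to (norm_dist N) 0 (?F b) \<le> ennreal \<kappa>"
    using \<kappa> dom order_trans by fastforce
  have "inverse ?\<delta> \<le> ennreal (norm_dist N 0 y)" if y: "y \<in> ?F b" for y
  proof -
    \<comment> \<open>The sign in \<open>- c\<close> comes from \<open>norm_dist\<close>, which
      measures the distance from 0 to \<open>c\<close> as the dual norm of
      \<open>0 - c\<close>.\<close>
    have ge: "1 \<le> dual_norm N (- c) * N y" if c: "c \<in> convex hull (a ` J)" for c
    proof -
      have "convex hull (a ` J) \<subseteq> {z. y \<bullet> z \<le> - 1}"
      proof (rule hull_minimal)
        have "y \<bullet> a t \<le> - 1" if "t \<in> J" for t
          using y that v[OF that] J(1) by (force simp: feasible_set_def b_def inner_commute)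
        then show "a ` J \<subseteq> {z. y \<bullet> z \<le> - 1}" by auto
      qed (rule convex_halfspace_le)
      with c have "1 \<le> \<bar>(- c) \<bullet> y\<bar>" by (force simp: inner_commute)
      with dual_norm_upper[OF N, of "- c" y] show ?thesis by linarith
    qed
    show ?thesis
    \<comment> \<open>For empty \<open>J\<close> the distance is \<infinity> and its inverse 0.
      Otherwise \<open>ge\<close> excludes \<open>N y = 0\<close>, so its reciprocal can be
      taken.\<close>
    proof (cases "J = {}")
      case False
      then obtain t where "t \<in> J" by blast
      then have "N y \<noteq> 0" using ge[of "a t"] by (force simp: hull_inc)
      then have Ny: "0 < N y" using is_normD(1)[OF N, of y] by simp
      have "ennreal (1 / N y) \<le> ?\<delta>"
        unfolding dist_to_def norm_dist_def using ge Ny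
        by (intro INF_greatest ennreal_leI) (simp add: field_simps)
      then have "inverse ?\<delta> \<le> inverse (ennreal (1 / N y))"
        by (rule ennreal_inverse_antimono)
      also have "\<dots> = ennreal (N y)" using Ny by (simp add: inverse_ennreal)
      finally show ?thesis using is_normD(5)[OF N, of y] by (simp add: norm_dist_def)
    qed (simp add: dist_to_def)
  qed
  then have "inverse ?\<delta> \<le> dist_to (norm_dist N) 0 (?F b)"
    unfolding dist_to_def[of "norm_dist N"] by (intro INF_greatest)
  with upper show "inverse ?\<delta> \<le> ennreal \<kappa>" by (rule order_trans[rotated])
qed

theorem theorem5:
  fixes T :: "'a::metric_space set"
    and a :: "'a \<Rightarrow> real ^ 'n"
    and N :: "real ^ 'n \<Rightarrow> real"
  assumes "is_norm N"
    and "compact T"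
    and "continuous_on T a"
  shows "Hof (C_space T) (norm_dist N) (feasible_set T a) =
    (SUP J\<in>{J. J \<subseteq> T \<and> compact J \<and> 0 \<notin> convex hull (a ` J)}.
       inverse (dist_to (norm_dist (dual_norm N)) 0 (convex hull (a ` J))))"
    (is "?H = ?S")
proof (rule antisym)
  show "?S \<le> ?H" using Hof_ge[OF assms] by (intro SUP_least) blast
  show "?H \<le> ?S"
  proof (cases ?S)
    case (real \<kappa>)
    \<comment> \<open>Finite sets are compact, so each such \<open>J\<close> occurs in the supremum;
      any single \<open>c\<close> in its hull bounds the distance from above and hence the inverse
      distance from below.\<close>
    have "1 \<le> \<kappa> * dual_norm N c"
      if J: "J \<subseteq> T" "finite J" "0 \<notin> convex hull (a ` J)" and c: "c \<in> convex hull (a ` J)" for J c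
    proof -
      have "- c \<noteq> 0" using J(3) c by auto
      then have pos: "0 < dual_norm N (- c)" by (rule dual_norm_pos[OF assms(1)])
      have "dist_to (norm_dist (dual_norm N)) 0 (convex hull (a ` J)) \<le> ennreal (dual_norm N (- c))"
        unfolding dist_to_def norm_dist_def using c by (intro INF_lower2[of c]) auto
      then have "inverse (ennreal (dual_norm N (- c)))
        \<le> inverse (dist_to (norm_dist (dual_norm N)) 0 (convex hull (a ` J)))"
        by (rule ennreal_inverse_antimono)
      also have "\<dots> \<le> ?S" using J by (intro SUP_upper) (simp add: finite_imp_compact)
      finally have "inverse (dual_norm N (- c)) \<le> \<kappa>"
        using real pos by (simp add: inverse_ennreal)
      moreover have "dual_norm N (- c) = dual_norm N c" by (simp add: dual_norm_def)
      ultimately show ?thesis using pos by (simp add: field_simps)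
    qed
    then show ?thesis using Hof_le[OF assms \<open>0 \<le> \<kappa>\<close>] real by simp
  next
    case top
    show ?thesis unfolding top by simp
  qed
qed

end
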